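(* Let $a,b\in\mathbb{N}$ and $\mathbf{c}=(c_1,c_2,\dots)$ with $c_j\in\mathbb{N}_0$. For $n,k\in\mathbb{N}$ let $\hat p(n,k)=|\mathscr{P}^{\mathbf{c}}_{a,b}(an+(b-2)k,k)|$ and write $r=an+(b-2)k$. Then, for $k>1$, \[ \frac{2(k-1)}{r+2}\,\hat p(n,k) = \sum_{\ell=1}^{k-1}\sum_{m=\ell}^{n-1} \hat p(n-m,k-\ell)\,\hat p(m,\ell). \]
   Context: For $a,b\in\mathbb{N}$ and $\mathbf{c}=(c_1,c_2,\dots)$, $c_j\in\mathbb{N}_0$, the set $\mathscr{P}^{\mathbf{c}}_{a,b}(r,k)$ consists of the colored partitions of a fixed convex $(r+2)$-gon (with distinguishable vertices) made by $k-1$ noncrossing diagonals into $k$ polygons, each of which has a number of sides congruent to $b$ modulo $a$, where each part which is an $(aj+b)$-gon ($j\ge 1$) is assigned one of $c_j$ colors. Thus $|\mathscr{P}^{\mathbf{c}}_{a,b}(r,k)|$ is the sum, over all such dissections into parts that are $(aj_1+b)$-gons, ..., $(aj_k+b)$-gons with $j_i\ge1$, of $c_{j_1}\cdots c_{j_k}$. (For such a dissection, $r=a(j_1+\dots+j_k)+(b-2)k$.) *)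

theory Defs
  imports Complex_Main "HOL-Library.FuncSet"
begin

text \<open>
  A convex polygon is represented by the finite set of its vertices, labelled by natural numbers
  in the order in which they occur along the boundary. A segment between two vertices is the pair
  of its end points, the smaller one first.
\<close>

definition segments :: "nat set \<Rightarrow> (nat \<times> nat) set" where
  "segments V = {(i, j). i \<in> V \<and> j \<in> V \<and> i < j}"

text \<open>
  The second disjunct gives the side that joins the last vertex to the first one.
\<close>

definition sides :: "nat set \<Rightarrow> (nat \<times> nat) set" where
  "sides V = {(i, j) \<in> segments V. V \<inter> {i<..<j} = {} \<or> V \<subseteq> {i..j}}"

definition diagonals :: "nat set \<Rightarrow> (nat \<times> nat) set" where
  "diagonals V = segments V - sides V"

text \<open>
  Segments that merely share an end point do not cross.
\<close>

fun crossing :: "nat \<times> nat \<Rightarrow> nat \<times> nat \<Rightarrow> bool" where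
  "crossing (i, j) (i', j') \<longleftrightarrow> (i < i' \<and> i' < j \<and> j < j') \<or> (i' < i \<and> i < j' \<and> j' < j)"

definition dissection :: "nat set \<Rightarrow> (nat \<times> nat) set \<Rightarrow> bool" where
  "dissection V D \<longleftrightarrow> D \<subseteq> diagonals V \<and> (\<forall>d\<in>D. \<forall>e\<in>D. \<not> crossing d e)"

text \<open>
  The polygons into which the polygon \<open>V\<close> is cut by the diagonals in \<open>D\<close>: each is bounded by sides
  of \<open>V\<close> and diagonals in \<open>D\<close>, and is not cut any further by \<open>D\<close>. (As \<open>D\<close> is noncrossing, a diagonal
  in \<open>D\<close> that meets the interior of such a polygon must join two of its vertices.) The number of
  sides of a part is its number of vertices.
\<close>

definition parts :: "nat set \<Rightarrow> (nat \<times> nat) set \<Rightarrow> nat set set" where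
  "parts V D =
    {P. P \<subseteq> V \<and> card P \<ge> 3 \<and> sides P \<subseteq> sides V \<union> D \<and> diagonals P \<inter> D = {}}"

text \<open>
  The colors available for an \<open>s\<close>-gon: there are \<open>c j\<close> of them if \<open>s = a * j + b\<close> with \<open>j \<ge> 1\<close>, and
  none if \<open>s\<close> is not of this form. The value \<open>c 0\<close> is not used.
\<close>

definition colors :: "nat \<Rightarrow> nat \<Rightarrow> (nat \<Rightarrow> nat) \<Rightarrow> nat \<Rightarrow> nat set" where
  "colors a b c s = {x. \<exists>j\<ge>1. s = a * j + b \<and> x < c j}"

text \<open>
  A colored partition is a dissection together with a coloring of its parts. Since a part of a
  dissection has some color only if its number of sides is of the form \<open>a * j + b\<close> with \<open>j \<ge> 1\<close>, no
  other parts occur. The parameter \<open>r\<close> is an integer because \<open>a * n + (b - 2) * k\<close> may be negative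
  for \<open>b = 1\<close>; there is no convex \<open>(r + 2)\<close>-gon, and hence no partition, unless \<open>r + 2 \<ge> 3\<close>.
\<close>

definition colored_partitions ::
  "nat \<Rightarrow> nat \<Rightarrow> (nat \<Rightarrow> nat) \<Rightarrow> int \<Rightarrow> nat \<Rightarrow> ((nat \<times> nat) set \<times> (nat set \<Rightarrow> nat)) set"
where
  "colored_partitions a b c r k =
    {(D, f). r + 2 \<ge> 3 \<and>
       dissection {0..<nat (r + 2)} D \<and> card D + 1 = k \<and>
       card (parts {0..<nat (r + 2)} D) = k \<and>
       f \<in> (\<Pi>\<^sub>E P \<in> parts {0..<nat (r + 2)} D. colors a b c (card P))}"

definition p_hat :: "nat \<Rightarrow> nat \<Rightarrow> (nat \<Rightarrow> nat) \<Rightarrow> nat \<Rightarrow> nat \<Rightarrow> nat" where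
  "p_hat a b c n k = card (colored_partitions a b c (int a * int n + (int b - 2) * int k) k)"

end

theory Submission imports Defs begin

text \<open>
  Count the pairs of a colored partition of the \<open>(r + 2)\<close>-gon and one of its \<open>k - 1\<close> diagonals. A
  diagonal cuts the polygon into two smaller ones, and the partitions containing it are the pairs
  of partitions of these two. The number of partitions depends only on the number of vertices;
  this is proved by induction on the number of parts from the double count itself, so that
  dissections never have to be transported between polygons. Finally, an \<open>(r + 2)\<close>-gon has a
  partition into \<open>k\<close> parts only if \<open>r = a * n + (b - 2) * k\<close> for some \<open>n \<ge> k\<close>, because the
  numbers of sides minus two of the parts add up to \<open>r\<close>.
\<close>

section \<open>Sides, diagonals and parts of a single polygon\<close>

lemma segments_iff: "(x, y) \<in> segments V \<longleftrightarrow> x \<in> V \<and> y \<in> V \<and> x < y"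
  by (simp add: segments_def)

lemma sides_iff:
  "(x, y) \<in> sides V \<longleftrightarrow> x \<in> V \<and> y \<in> V \<and> x < y \<and>
     ((\<forall>v\<in>V. \<not> (x < v \<and> v < y)) \<or> (\<forall>v\<in>V. x \<le> v \<and> v \<le> y))"
  by (auto simp: sides_def segments_def)

lemma diagonals_iff:
  "(x, y) \<in> diagonals V \<longleftrightarrow> x \<in> V \<and> y \<in> V \<and> x < y \<and>
     (\<exists>v\<in>V. x < v \<and> v < y) \<and> (\<exists>v\<in>V. v < x \<or> y < v)"
  unfolding diagonals_def Diff_iff segments_iff sides_iff by (auto simp: not_le)

lemma finite_diagonals: "finite V \<Longrightarrow> finite (diagonals V)"
  by (rule finite_subset[of _ "V \<times> V"]) (auto simp: diagonals_def segments_def)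

lemma finite_dissection: "finite V \<Longrightarrow> dissection V D \<Longrightarrow> finite D"
  using finite_diagonals finite_subset unfolding dissection_def by blast

lemma finite_dissections: "finite V \<Longrightarrow> finite {D. dissection V D}"
  by (rule finite_subset[of _ "Pow (diagonals V)"]) (auto simp: dissection_def finite_diagonals)

lemma finite_parts: "finite V \<Longrightarrow> finite (parts V D)"
  by (rule finite_subset[of _ "Pow V"]) (auto simp: parts_def)

text \<open>Deleting vertices keeps a gap a gap and an extremal pair extremal; \<open>P\<close>
  serves to place both end points in \<open>U\<close>.\<close>

lemma sides_antimono: "P \<subseteq> U \<Longrightarrow> U \<subseteq> V \<Longrightarrow> e \<in> sides P \<Longrightarrow> e \<in> sides V \<Longrightarrow> e \<in> sides U"
  by (cases e) (auto simp: sides_iff)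

lemma sides_segments: "P \<subseteq> U \<Longrightarrow> e \<in> sides P \<Longrightarrow> e \<in> segments U"
  by (cases e) (auto simp: sides_iff segments_iff)

lemma diagonals_segments: "P \<subseteq> U \<Longrightarrow> e \<in> diagonals P \<Longrightarrow> e \<in> segments U"
  by (cases e) (auto simp: diagonals_iff segments_iff)

lemma ex_third_element:
  assumes "card (P :: 'a set) \<ge> 3"
  shows "\<exists>z\<in>P. z \<noteq> x \<and> z \<noteq> y"
proof (rule ccontr)
  assume "\<not> ?thesis"
  hence "P \<subseteq> {x, y}" by auto
  hence "card P \<le> card {x, y}" by (intro card_mono) auto
  also have "\<dots> \<le> 2" by (simp add: card_insert_if)
  finally show False using assms by simp
qed

lemma greatest_below:
  assumes "finite (P :: nat set)" "p \<in> P" "p < x"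
  obtains q where "q \<in> P" "q < x" "\<forall>v\<in>P. v < x \<longrightarrow> v \<le> q"
proof -
  have *: "finite {v\<in>P. v < x}" "{v\<in>P. v < x} \<noteq> {}" using assms by auto
  show ?thesis using that[of "Max {v\<in>P. v < x}"] Max_in[OF *] Max_ge[OF *(1)] by auto
qed

lemma least_above:
  assumes "finite (P :: nat set)" "p \<in> P" "x < p"
  obtains q where "q \<in> P" "x < q" "\<forall>v\<in>P. x < v \<longrightarrow> q \<le> v"
proof -
  have *: "finite {v\<in>P. x < v}" "{v\<in>P. x < v} \<noteq> {}" using assms by auto
  show ?thesis using that[of "Min {v\<in>P. x < v}"] Min_in[OF *] Min_le[OF *(1)] by auto
qed

text \<open>A vertex \<open>v\<close> of \<open>V\<close> missing from \<open>P\<close> would lie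
  between two consecutive vertices of \<open>P\<close>. The side joining these would be a side of
  \<open>V\<close> with \<open>v\<close> strictly inside its range, hence the closing side of
  \<open>V\<close>, and \<open>P\<close> could have no third vertex.\<close>

lemma polygon_eqI_sides_subset:
  assumes "finite V" "P \<subseteq> V" "card P \<ge> 3" "sides P \<subseteq> sides V"
  shows "P = V"
proof (rule ccontr)
  assume "P \<noteq> V"
  then obtain v where v: "v \<in> V" "v \<notin> P" using assms(2) by auto
  have fP: "finite P" using assms finite_subset by blast
  have ne: "P \<noteq> {}" using assms(3) by auto
  have m: "Min P \<in> P" "Max P \<in> P" "\<forall>x\<in>P. Min P \<le> x \<and> x \<le> Max P"
    using fP ne by auto
  obtain z where z: "z \<in> P" "z \<noteq> Min P" "z \<noteq> Max P"
    using ex_third_element[OF assms(3)] by blast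
  have z': "Min P < z" "z < Max P" using z m by force+
  hence "(Min P, Max P) \<in> sides P" using m unfolding sides_iff by auto
  hence "(Min P, Max P) \<in> sides V" using assms(4) by auto
  \<comment> \<open>The vertex \<open>z\<close> prevents \<open>(Min P, Max P)\<close> from being a
    gap of \<open>V\<close>, so it is the closing side and bounds all of \<open>V\<close>.\<close>
  hence "Min P \<le> v" "v \<le> Max P" using z z' v(1) assms(2) unfolding sides_iff by blast+
  hence lt: "Min P < v" "v < Max P" using m v(2) by (metis order_le_imp_less_or_eq)+
  obtain p where p: "p \<in> P" "p < v" "\<forall>u\<in>P. u < v \<longrightarrow> u \<le> p"
    using greatest_below[OF fP m(1) lt(1)] by blast
  obtain q where q: "q \<in> P" "v < q" "\<forall>u\<in>P. v < u \<longrightarrow> q \<le> u"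
    using least_above[OF fP m(2) lt(2)] by blast
  have gap: "\<forall>u\<in>P. \<not> (p < u \<and> u < q)"
    using p(3) q(3) v(2) by (metis linorder_neqE_nat not_le)
  hence "(p, q) \<in> sides P" using p q unfolding sides_iff by auto
  hence "(p, q) \<in> sides V" using assms(4) by auto
  hence "\<forall>u\<in>V. p \<le> u \<and> u \<le> q" using v(1) p(2) q(2) unfolding sides_iff by blast
  moreover obtain u where "u \<in> P" "u \<noteq> p" "u \<noteq> q"
    using ex_third_element[OF assms(3)] by blast
  ultimately show False using gap assms(2) by (metis in_mono order_le_imp_less_or_eq)
qed

lemma parts_empty:
  assumes "finite V" "card V \<ge> 3"
  shows "parts V {} = {V}"
  using polygon_eqI_sides_subset[OF assms(1)] assms(2) by (auto simp: parts_def)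

section \<open>Cutting a polygon along a diagonal and gluing the two pieces\<close>

locale cut_polygon =
  fixes V :: "nat set" and i j :: nat
  assumes fin: "finite V" and diag: "(i, j) \<in> diagonals V"
begin

text \<open>Both pieces keep the end points of the diagonal \<open>(i, j)\<close>. It becomes the
  closing side of \<open>inner\<close> and a side without vertices in between of
  \<open>outer\<close>.\<close>

definition "inner = V \<inter> {i..j}"
definition "outer = V - {i<..<j}"

lemma ij: "i \<in> V" "j \<in> V" "i < j" and ex_inner: "\<exists>v\<in>V. i < v \<and> v < j"
  and ex_outer: "\<exists>v\<in>V. v < i \<or> j < v"
  using diag by (auto simp: diagonals_iff)

lemma finite_inner: "finite inner" and finite_outer: "finite outer"
  using fin by (auto simp: inner_def outer_def)

lemma inner_iff: "v \<in> inner \<longleftrightarrow> v \<in> V \<and> i \<le> v \<and> v \<le> j"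
  by (auto simp: inner_def)

lemma outer_iff: "v \<in> outer \<longleftrightarrow> v \<in> V \<and> (v \<le> i \<or> j \<le> v)"
  by (auto simp: outer_def)

lemma card_inner: "card inner \<ge> 3"
proof -
  obtain v where v: "v \<in> V" "i < v" "v < j" using ex_inner by auto
  have "card {i, v, j} \<le> card inner"
    using v ij finite_inner by (intro card_mono) (auto simp: inner_iff)
  thus ?thesis using v ij by simp
qed

lemma card_outer: "card outer \<ge> 3"
proof -
  obtain v where v: "v \<in> V" "v < i \<or> j < v" using ex_outer by auto
  have "card {i, v, j} \<le> card outer"
    using v ij finite_outer by (intro card_mono) (auto simp: outer_iff)
  moreover have "card {i, v, j} = 3" using v ij by auto
  ultimately show ?thesis by simp
qed

lemma card_inner_outer: "card inner + card outer = card V + 2"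
proof -
  have "inner \<union> outer = V" "inner \<inter> outer = {i, j}"
    using ij by (auto simp: inner_iff outer_iff)
  thus ?thesis using card_Un_Int[OF finite_inner finite_outer] ij by simp
qed

lemma segments_inner_outer:
  "e \<in> segments inner \<Longrightarrow> e \<in> segments outer \<Longrightarrow> e = (i, j)"
  using ij by (cases e) (auto simp: segments_iff inner_iff outer_iff)

lemma diagonals_inner_subset: "diagonals inner \<subseteq> diagonals V"
  by (rule subrelI) (unfold diagonals_iff inner_iff Bex_def, blast)

lemma diagonals_outer_subset: "diagonals outer \<subseteq> diagonals V"
  by (rule subrelI) (unfold diagonals_iff outer_iff Bex_def, blast)

lemma ij_notin: "(i, j) \<notin> diagonals inner" "(i, j) \<notin> diagonals outer"
  by (auto simp: diagonals_iff inner_iff outer_iff)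

lemma diagonals_disjoint: "diagonals inner \<inter> diagonals outer = {}"
  using segments_inner_outer ij_notin unfolding diagonals_def by blast

text \<open>A segment that does not cross \<open>(i, j)\<close> has both ends in one piece. It stays
  a diagonal there because whenever a witnessing vertex of \<open>V\<close> is lost,
  \<open>i\<close> or \<open>j\<close> takes over its role.\<close>

lemma diagonal_cases:
  assumes "e \<in> diagonals V" "\<not> crossing e (i, j)"
  shows "e = (i, j) \<or> e \<in> diagonals inner \<or> e \<in> diagonals outer"
proof -
  obtain x y where e: "e = (x, y)" by (cases e)
  have xy: "x \<in> V" "y \<in> V" "x < y" "\<exists>v\<in>V. x < v \<and> v < y" "\<exists>v\<in>V. v < x \<or> y < v"
    using assms(1) by (auto simp: e diagonals_iff)
  consider "e = (i, j)" | "i \<le> x" "y \<le> j" "e \<noteq> (i, j)"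
    | "x \<le> i \<or> j \<le> x" "y \<le> i \<or> j \<le> y" "e \<noteq> (i, j)"
  proof -
    have "i \<le> x \<and> y \<le> j \<or> (x \<le> i \<or> j \<le> x) \<and> (y \<le> i \<or> j \<le> y)"
      using assms(2) ij(3) xy(3) unfolding e crossing.simps by linarith
    thus ?thesis using that by blast
  qed
  thus ?thesis
  proof cases
    case 2
    have "\<exists>v\<in>inner. x < v \<and> v < y" using xy(4) 2 by (force simp: inner_iff)
    moreover have "\<exists>v\<in>inner. v < x \<or> y < v"
    proof (cases "i < x")
      case True thus ?thesis using ij by (intro bexI[of _ i]) (auto simp: inner_iff)
    next
      case False
      hence "y < j" using 2 by (auto simp: e)
      thus ?thesis using ij by (intro bexI[of _ j]) (auto simp: inner_iff)
    qed
    ultimately show ?thesis using xy 2 by (auto simp: e diagonals_iff inner_iff)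
  next
    case 3
    have "\<exists>v\<in>outer. v < x \<or> y < v"
    proof -
      obtain v where v: "v \<in> V" "v < x \<or> y < v" using xy(5) by auto
      show ?thesis
      proof (cases "v \<in> outer")
        case False
        hence "i < v" "v < j" using v by (auto simp: outer_iff)
        hence "i < x \<or> y < j" using v(2) by auto
        thus ?thesis using ij by (auto simp: outer_iff)
      qed (use v in auto)
    qed
    moreover have "\<exists>v\<in>outer. x < v \<and> v < y"
    proof -
      obtain v where v: "v \<in> V" "x < v" "v < y" using xy(4) by auto
      show ?thesis
      proof (cases "v \<in> outer")
        case False
        hence "i < v" "v < j" using v by (auto simp: outer_iff)
        hence "x \<le> i" "j \<le> y" using v 3 by auto
        \<comment> \<open>As \<open>e\<close> is not \<open>(i, j)\<close>, its range extends
          strictly beyond \<open>i\<close> or beyond \<open>j\<close>; that end point then lies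
          strictly inside.\<close>
        hence "x < i \<or> j < y" using 3 by (auto simp: e)
        hence "x < i \<and> i < y \<or> x < j \<and> j < y" using \<open>x \<le> i\<close> \<open>j \<le> y\<close> ij(3) by auto
        moreover have "i \<in> outer" "j \<in> outer" using ij by (auto simp: outer_iff)
        ultimately show ?thesis by blast
      qed (use v in auto)
    qed
    ultimately show ?thesis using xy 3 by (auto simp: e diagonals_iff outer_iff)
  qed auto
qed

text \<open>Segments of \<open>D1\<close> stay within the range from \<open>i\<close> to
  \<open>j\<close>, while no segment of \<open>D2\<close> has an end point strictly inside it, so
  the two families cross neither each other nor \<open>(i, j)\<close>.\<close>

lemma dissection_glue:
  assumes "dissection inner D1" "dissection outer D2"
  shows "dissection V (insert (i, j) (D1 \<union> D2))"
proof -
  have D: "D1 \<subseteq> diagonals inner" "D2 \<subseteq> diagonals outer"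
    "\<forall>d\<in>D1. \<forall>e\<in>D1. \<not> crossing d e" "\<forall>d\<in>D2. \<forall>e\<in>D2. \<not> crossing d e"
    using assms by (auto simp: dissection_def)
  have in1: "i \<le> x \<and> x < y \<and> y \<le> j" if "(x, y) \<in> D1" for x y
    using D(1) that by (auto simp: diagonals_iff inner_iff)
  have in2: "(x \<le> i \<or> j \<le> x) \<and> x < y \<and> (y \<le> i \<or> j \<le> y)" if "(x, y) \<in> D2" for x y
    using D(2) that by (auto simp: diagonals_iff outer_iff)
  have c12: "\<not> crossing d e \<and> \<not> crossing e d" if "d \<in> D1" "e \<in> D2" for d e
    using in1[of "fst d" "snd d"] in2[of "fst e" "snd e"] that
    by (cases d; cases e) auto
  have c1: "\<not> crossing d (i, j) \<and> \<not> crossing (i, j) d" if "d \<in> D1" for d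
    using in1[of "fst d" "snd d"] that by (cases d) auto
  have c2: "\<not> crossing d (i, j) \<and> \<not> crossing (i, j) d" if "d \<in> D2" for d
    using in2[of "fst d" "snd d"] that by (cases d) auto
  have "insert (i, j) (D1 \<union> D2) \<subseteq> diagonals V"
    using D diag diagonals_inner_subset diagonals_outer_subset by blast
  moreover have "\<not> crossing (i, j) (i, j)" by simp
  ultimately show ?thesis
    unfolding dissection_def ball_simps(7) ball_Un using D(3,4) c12 c1 c2 by simp
qed

text \<open>The inverse of gluing: by \<open>diagonal_cases\<close>, restricting \<open>D\<close> to
  the diagonals of the two pieces loses only \<open>(i, j)\<close> itself.\<close>

lemma dissection_cut:
  assumes "dissection V D" "(i, j) \<in> D"
  shows "dissection inner (D \<inter> diagonals inner)" "dissection outer (D \<inter> diagonals outer)"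
    "insert (i, j) ((D \<inter> diagonals inner) \<union> (D \<inter> diagonals outer)) = D"
proof -
  have D: "D \<subseteq> diagonals V" "\<forall>d\<in>D. \<forall>e\<in>D. \<not> crossing d e"
    using assms(1) by (auto simp: dissection_def)
  show "dissection inner (D \<inter> diagonals inner)" "dissection outer (D \<inter> diagonals outer)"
    using D(2) by (auto simp: dissection_def simp del: crossing.simps)
  have "e = (i, j) \<or> e \<in> diagonals inner \<or> e \<in> diagonals outer" if "e \<in> D" for e
    using D that assms(2) by (intro diagonal_cases) auto
  thus "insert (i, j) ((D \<inter> diagonals inner) \<union> (D \<inter> diagonals outer)) = D"
    using assms(2) by blast
qed

text \<open>Suppose \<open>P\<close> has vertices strictly on both sides of the diagonal. If
  \<open>i\<close> or \<open>j\<close> were not in \<open>P\<close>, the two vertices of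
  \<open>P\<close> around that point would span a side of \<open>P\<close> crossing
  \<open>(i, j)\<close>. With both in \<open>P\<close>, \<open>(i, j)\<close> is a diagonal of
  \<open>P\<close> that belongs to \<open>D\<close>.\<close>

lemma part_inner_or_outer:
  assumes "dissection V D" "(i, j) \<in> D" "P \<in> parts V D"
  shows "P \<subseteq> inner \<or> P \<subseteq> outer"
proof (rule ccontr)
  assume n: "\<not> ?thesis"
  have P: "P \<subseteq> V" "sides P \<subseteq> sides V \<union> D" "diagonals P \<inter> D = {}"
    using assms(3) by (auto simp: parts_def)
  have fP: "finite P" using P(1) fin finite_subset by blast
  obtain x where x: "x \<in> P" "i < x" "x < j" using n P(1) by (fastforce simp: outer_iff)
  obtain y where y: "y \<in> P" "y < i \<or> j < y" using n P(1) by (fastforce simp: inner_iff)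
  \<comment> \<open>Every side of \<open>P\<close> belongs to \<open>D\<close>, where nothing
    crosses, or is a side of \<open>V\<close>, and those cross no diagonal.\<close>
  have nocross: "\<not> crossing (p, q) (i, j)" if "(p, q) \<in> sides P" for p q
  proof
    assume c: "crossing (p, q) (i, j)"
    have "(p, q) \<in> sides V" using that P(2) c assms(1,2) unfolding dissection_def by blast
    thus False using c ij by (force simp: sides_iff)
  qed
  have *: "(p, q) \<in> sides P"
    if "p \<in> P" "q \<in> P" "p < q" "\<forall>v\<in>P. v < q \<longrightarrow> v \<le> p" for p q
    using that by (force simp: sides_iff)
  have ends: "(p, q) \<in> sides P"
    if "p \<in> P" "q \<in> P" "p < q" "\<forall>v\<in>P. p \<le> v \<and> v \<le> q" for p q
    using that by (force simp: sides_iff)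
  have "i \<in> P"
  proof (rule ccontr)
    assume iP: "i \<notin> P"
    obtain z where z: "z \<in> P" "i < z" "\<forall>v\<in>P. i < v \<longrightarrow> z \<le> v"
      using least_above[OF fP x(1,2)] by blast
    have zj: "z < j" using z x by fastforce
    show False
    proof (cases "\<exists>p\<in>P. p < i")
      case True
      then obtain p where p: "p \<in> P" "p < i" "\<forall>v\<in>P. v < i \<longrightarrow> v \<le> p"
        using greatest_below[OF fP] by blast
      have "\<forall>v\<in>P. v < z \<longrightarrow> v \<le> p"
        using p(3) z(3) iP by (metis linorder_neqE_nat not_le)
      hence "(p, z) \<in> sides P" using p z by (intro *) auto
      thus False using nocross[of p z] p z zj by auto
    next
      \<comment> \<open>No vertex of \<open>P\<close> precedes \<open>i\<close>, so the cyclic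
        predecessor of \<open>z\<close> is \<open>Max P\<close>, and the closing side of
        \<open>P\<close> crosses the diagonal.\<close>
      case False
      hence low: "\<forall>v\<in>P. z \<le> v" using z(3) iP by (metis linorder_neqE_nat)
      have "j < y" using y False by auto
      moreover have "y \<le> Max P" using y fP by auto
      moreover have "Max P \<in> P" using y fP by (intro Max_in) auto
      ultimately have "(z, Max P) \<in> sides P" using z zj low fP by (intro ends) auto
      thus False using nocross[of z "Max P"] z zj \<open>j < y\<close> \<open>y \<le> Max P\<close> by auto
    qed
  qed
  moreover have "j \<in> P"
  proof (rule ccontr)
    assume jP: "j \<notin> P"
    obtain z where z: "z \<in> P" "z < j" "\<forall>v\<in>P. v < j \<longrightarrow> v \<le> z"
      using greatest_below[OF fP x(1,3)] by blast
    have iz: "i < z" using z x by fastforce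
    show False
    proof (cases "\<exists>p\<in>P. j < p")
      case True
      then obtain p where p: "p \<in> P" "j < p" "\<forall>v\<in>P. j < v \<longrightarrow> p \<le> v"
        using least_above[OF fP] by blast
      have "\<forall>v\<in>P. v < p \<longrightarrow> v \<le> z"
        using p(3) z(3) jP by (metis linorder_neqE_nat not_le)
      hence "(z, p) \<in> sides P" using p z by (intro *) auto
      thus False using nocross[of z p] p z iz by auto
    next
      case False
      hence high: "\<forall>v\<in>P. v \<le> z" using z(3) jP by (metis linorder_neqE_nat)
      have "y < i" using y False by auto
      moreover have "Min P \<le> y" using y fP by auto
      moreover have "Min P \<in> P" using y fP by (intro Min_in) auto
      ultimately have "(Min P, z) \<in> sides P" using z iz high fP by (intro ends) auto
      thus False using nocross[of "Min P" z] z iz \<open>y < i\<close> \<open>Min P \<le> y\<close> by auto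
    qed
  qed
  ultimately have "(i, j) \<in> diagonals P" using x y ij by (auto simp: diagonals_iff)
  thus False using P(3) assms(2) by blast
qed

lemma sides_inner: "sides inner \<subseteq> insert (i, j) (sides V)"
proof (rule subrelI)
  fix x y assume a: "(x, y) \<in> sides inner"
  hence xy: "x \<in> V" "y \<in> V" "x < y" "i \<le> x" "y \<le> j" by (auto simp: sides_iff inner_iff)
  have inn: "i \<in> inner" "j \<in> inner" using ij by (auto simp: inner_iff)
  show "(x, y) \<in> insert (i, j) (sides V)"
  proof (cases "\<forall>v\<in>inner. x \<le> v \<and> v \<le> y")
    case True
    hence "x \<le> i" "j \<le> y" using inn by auto
    thus ?thesis using xy by simp
  next
    case False
    hence "\<forall>v\<in>inner. \<not> (x < v \<and> v < y)" using a by (auto simp: sides_iff)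
    hence "\<forall>v\<in>V. \<not> (x < v \<and> v < y)" using xy by (auto simp: inner_iff)
    thus ?thesis using xy by (simp add: sides_iff)
  qed
qed

lemma sides_outer: "sides outer \<subseteq> insert (i, j) (sides V)"
proof (rule subrelI)
  fix x y assume a: "(x, y) \<in> sides outer"
  hence xy: "x \<in> outer" "y \<in> outer" "x < y" by (auto simp: sides_iff)
  have out: "i \<in> outer" "j \<in> outer" using ij by (auto simp: outer_iff)
  show "(x, y) \<in> insert (i, j) (sides V)"
  proof (cases "\<forall>v\<in>outer. x \<le> v \<and> v \<le> y")
    case True
    hence "\<forall>v\<in>V. x \<le> v \<and> v \<le> y" using out
      by (metis outer_iff nat_le_linear order_trans)
    thus ?thesis using xy by (auto simp: sides_iff outer_iff)
  next
    case False
    hence gap: "\<forall>v\<in>outer. \<not> (x < v \<and> v < y)" using a by (auto simp: sides_iff)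
    show ?thesis
    proof (cases "(x, y) = (i, j)")
      case ne: False
      have "\<not> (x < v \<and> v < y)" if "v \<in> V" for v
      proof
        assume v: "x < v \<and> v < y"
        hence "v \<notin> outer" using gap by auto
        hence "i < v" "v < j" using that by (auto simp: outer_iff)
        hence "x \<le> i" "j \<le> y" using v xy by (auto simp: outer_iff)
        \<comment> \<open>The gap from \<open>x\<close> to \<open>y\<close> spans \<open>i\<close>
          and \<open>j\<close>, which are vertices of \<open>outer\<close> and so cannot lie
          strictly inside it.\<close>
        hence "x = i" "y = j" using gap out ij(3) by (metis le_less le_less_trans less_le_trans)+
        thus False using ne by simp
      qed
      thus ?thesis using xy by (auto simp: sides_iff outer_iff)
    qed simp
  qed
qed

lemma ij_side: "(i, j) \<in> sides inner" "(i, j) \<in> sides outer"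
  using ij by (auto simp: sides_iff inner_iff outer_iff)

text \<open>A part of the whole lies in one piece. Its sides that are sides of \<open>V\<close> are
  sides of that piece; those from the other dissection can only be \<open>(i, j)\<close>, the one
  segment common to both pieces, which is also a side of each. Conversely, passing from a piece to
  \<open>V\<close> turns no side except \<open>(i, j)\<close> into a diagonal, and
  \<open>(i, j)\<close> is in the glued dissection.\<close>

lemma parts_glue:
  assumes "dissection inner D1" "dissection outer D2"
  shows "parts V (insert (i, j) (D1 \<union> D2)) = parts inner D1 \<union> parts outer D2" (is "parts V ?D = _")
proof (intro equalityI subsetI)
  have D: "D1 \<subseteq> segments inner" "D2 \<subseteq> segments outer"
    using assms by (auto simp: dissection_def diagonals_def)
  have sub: "inner \<subseteq> V" "outer \<subseteq> V" by (auto simp: inner_iff outer_iff)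
  fix P assume P: "P \<in> parts V ?D"
  have P': "P \<subseteq> V" "card P \<ge> 3" "sides P \<subseteq> sides V \<union> ?D" "diagonals P \<inter> ?D = {}"
    using P by (auto simp: parts_def)
  have "P \<subseteq> inner \<or> P \<subseteq> outer"
    using part_inner_or_outer[OF dissection_glue[OF assms] _ P] by simp
  thus "P \<in> parts inner D1 \<union> parts outer D2"
  proof
    assume "P \<subseteq> inner"
    moreover from this have "sides P \<subseteq> sides inner \<union> D1"
      using P'(3) sides_antimono[of P inner] sides_segments[of P inner] sub ij_side
        segments_inner_outer D unfolding subset_iff Un_iff insert_iff by metis
    ultimately show ?thesis using P' by (auto simp: parts_def)
  next
    assume "P \<subseteq> outer"
    moreover from this have "sides P \<subseteq> sides outer \<union> D2"
      using P'(3) sides_antimono[of P outer] sides_segments[of P outer] sub ij_side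
        segments_inner_outer D unfolding subset_iff Un_iff insert_iff by metis
    ultimately show ?thesis using P' by (auto simp: parts_def)
  qed
next
  have D: "D1 \<subseteq> segments inner" "D2 \<subseteq> segments outer"
    using assms by (auto simp: dissection_def diagonals_def)
  have sub: "inner \<subseteq> V" "outer \<subseteq> V" by (auto simp: inner_iff outer_iff)
  fix P assume "P \<in> parts inner D1 \<union> parts outer D2"
  thus "P \<in> parts V ?D"
  proof
    assume "P \<in> parts inner D1"
    hence P: "P \<subseteq> inner" "card P \<ge> 3" "sides P \<subseteq> sides inner \<union> D1" "diagonals P \<inter> D1 = {}"
      by (auto simp: parts_def)
    have "(i, j) \<notin> diagonals P" using P(1) by (auto simp: diagonals_iff inner_iff)
    hence "diagonals P \<inter> ?D = {}"
      using P(4) diagonals_segments[OF P(1)] D(2) segments_inner_outer by blast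
    thus ?thesis using P sub sides_inner by (auto simp: parts_def)
  next
    assume "P \<in> parts outer D2"
    hence P: "P \<subseteq> outer" "card P \<ge> 3" "sides P \<subseteq> sides outer \<union> D2" "diagonals P \<inter> D2 = {}"
      by (auto simp: parts_def)
    have "(i, j) \<notin> diagonals P" using P(1) by (auto simp: diagonals_iff outer_iff)
    hence "diagonals P \<inter> ?D = {}"
      using P(4) diagonals_segments[OF P(1)] D(1) segments_inner_outer by blast
    thus ?thesis using P sub sides_outer by (auto simp: parts_def)
  qed
qed

lemma parts_disjoint: "parts inner D1 \<inter> parts outer D2 = {}"
proof -
  have "card P < 3" if "P \<subseteq> inner" "P \<subseteq> outer" for P
  proof -
    have "inner \<inter> outer = {i, j}" using ij by (auto simp: inner_iff outer_iff)
    hence "P \<subseteq> {i, j}" using that by blast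
    hence "card P \<le> card {i, j}" by (intro card_mono) auto
    thus ?thesis using ij by simp
  qed
  hence "\<not> (P \<in> parts inner D1 \<and> P \<in> parts outer D2)" for P
    unfolding parts_def mem_Collect_eq by (meson not_le)
  thus ?thesis by blast
qed

lemma card_glue:
  assumes "dissection inner D1" "dissection outer D2"
  shows "card (insert (i, j) (D1 \<union> D2)) = card D1 + card D2 + 1"
proof -
  have "D1 \<subseteq> diagonals inner" "D2 \<subseteq> diagonals outer"
    using assms by (auto simp: dissection_def)
  hence "D1 \<inter> D2 = {}" "(i, j) \<notin> D1 \<union> D2" using diagonals_disjoint ij_notin by blast+
  moreover have "finite D1" "finite D2"
    using assms finite_dissection finite_inner finite_outer by blast+
  ultimately show ?thesis by (simp add: card_Un_disjoint)
qed

end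

section \<open>Number and sizes of the parts; weighted counts of dissections\<close>

lemma card_parts_and_excess:
  assumes "finite V" "card V \<ge> 3" "dissection V D"
  shows "card (parts V D) = card D + 1 \<and>
    (\<Sum>P\<in>parts V D. int (card P) - 2) = int (card V) - 2"
  using assms
\<comment> \<open>Cutting along any diagonal leaves fewer diagonals in each piece. The excess, the
  number of vertices minus two, is additive because the pieces share two vertices.\<close>
proof (induction "card D" arbitrary: V D rule: less_induct)
  case less
  show ?case
  proof (cases "D = {}")
    case True
    thus ?thesis using parts_empty[OF less.prems(1,2)] by simp
  next
    case False
    then obtain i j where d: "(i, j) \<in> D" by auto
    interpret cut_polygon V i j
      using less.prems d by unfold_locales (auto simp: dissection_def)
    let ?D1 = "D \<inter> diagonals inner" and ?D2 = "D \<inter> diagonals outer"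
    note cut = dissection_cut[OF less.prems(3) d]
    have cD: "card D = card ?D1 + card ?D2 + 1"
      using card_glue[OF cut(1,2)] unfolding cut(3) .
    have pD: "parts V D = parts inner ?D1 \<union> parts outer ?D2"
      using parts_glue[OF cut(1,2)] unfolding cut(3) .
    have 1: "card (parts inner ?D1) = card ?D1 + 1"
        "(\<Sum>P\<in>parts inner ?D1. int (card P) - 2) = int (card inner) - 2"
      using less.hyps[of ?D1 inner] cD finite_inner card_inner cut(1) by auto
    have 2: "card (parts outer ?D2) = card ?D2 + 1"
        "(\<Sum>P\<in>parts outer ?D2. int (card P) - 2) = int (card outer) - 2"
      using less.hyps[of ?D2 outer] cD finite_outer card_outer cut(2) by auto
    note fp = finite_parts[OF finite_inner, of ?D1] finite_parts[OF finite_outer, of ?D2]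
    show ?thesis
      unfolding pD card_Un_disjoint[OF fp parts_disjoint] sum.union_disjoint[OF fp parts_disjoint]
      using 1 2 cD card_inner_outer by simp
  qed
qed

text \<open>With \<open>w s\<close> the number of colors of an \<open>s\<close>-gon, this counts
  colored partitions into \<open>k\<close> parts. A general \<open>w\<close> keeps colors out of the
  geometry.\<close>

definition dissection_weight :: "(nat \<Rightarrow> nat) \<Rightarrow> nat set \<Rightarrow> nat \<Rightarrow> nat" where
  "dissection_weight w V k =
    (\<Sum>D | dissection V D \<and> card D + 1 = k. \<Prod>P\<in>parts V D. w (card P))"

text \<open>Cutting and gluing are inverse bijections between the dissections containing
  \<open>(i, j)\<close> and the pairs of dissections of the pieces. Here \<open>l\<close> is the
  number of parts of \<open>inner\<close>, and weights multiply since the parts of the pieces form a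
  disjoint union.\<close>

lemma (in cut_polygon) sum_dissections_through_diagonal:
  "(\<Sum>D | dissection V D \<and> card D + 1 = k \<and> (i, j) \<in> D. \<Prod>P\<in>parts V D. w (card P)) =
    (\<Sum>l = 1..k - 1. dissection_weight w inner l * dissection_weight w outer (k - l))"
proof -
  let ?A = "\<lambda>U l. {D. dissection U D \<and> card D + 1 = l}"
  let ?g = "\<lambda>U D. \<Prod>P\<in>parts U D. w (card P)"
  let ?S = "SIGMA l:{1..k - 1}. ?A inner l \<times> ?A outer (k - l)"
  have fin': "finite (?A inner l)" "finite (?A outer l)" for l
    using finite_dissections[OF finite_inner] finite_dissections[OF finite_outer]
    by (auto intro: rev_finite_subset)
  have "(\<Sum>l = 1..k - 1. dissection_weight w inner l * dissection_weight w outer (k - l)) =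
      (\<Sum>l = 1..k - 1. \<Sum>(D1, D2)\<in>?A inner l \<times> ?A outer (k - l). ?g inner D1 * ?g outer D2)"
    unfolding dissection_weight_def sum_product sum.cartesian_product ..
  also have "\<dots> = (\<Sum>(l, D1, D2)\<in>?S. ?g inner D1 * ?g outer D2)"
    using fin' by (subst sum.Sigma) auto
  also have "\<dots> = (\<Sum>D | dissection V D \<and> card D + 1 = k \<and> (i, j) \<in> D. ?g V D)"
  proof (rule sum.reindex_bij_witness[where
        j = "\<lambda>(l, D1, D2). insert (i, j) (D1 \<union> D2)" and
        i = "\<lambda>D. (card (D \<inter> diagonals inner) + 1, D \<inter> diagonals inner, D \<inter> diagonals outer)"])
    fix s assume "s \<in> ?S"
    then obtain l D1 D2 where s: "s = (l, D1, D2)" "l \<in> {1..k - 1}"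
      "dissection inner D1" "card D1 + 1 = l" "dissection outer D2" "card D2 + 1 = k - l"
      by auto
    have "D1 \<subseteq> diagonals inner" "D2 \<subseteq> diagonals outer"
      using s by (auto simp: dissection_def)
    hence "insert (i, j) (D1 \<union> D2) \<inter> diagonals inner = D1"
      "insert (i, j) (D1 \<union> D2) \<inter> diagonals outer = D2"
      using diagonals_disjoint ij_notin by blast+
    thus "(\<lambda>D. (card (D \<inter> diagonals inner) + 1, D \<inter> diagonals inner, D \<inter> diagonals outer))
        ((\<lambda>(l, D1, D2). insert (i, j) (D1 \<union> D2)) s) = s"
      using s by simp
    show "(\<lambda>(l, D1, D2). insert (i, j) (D1 \<union> D2)) s
        \<in> {D. dissection V D \<and> card D + 1 = k \<and> (i, j) \<in> D}"
      using dissection_glue[OF s(3,5)] card_glue[OF s(3,5)] s by simp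
    show "?g V ((\<lambda>(l, D1, D2). insert (i, j) (D1 \<union> D2)) s) =
        (case s of (l, D1, D2) \<Rightarrow> ?g inner D1 * ?g outer D2)"
      using prod.union_disjoint[OF finite_parts[OF finite_inner] finite_parts[OF finite_outer]
          parts_disjoint]
      by (simp add: s(1) parts_glue[OF s(3,5)])
  next
    fix D assume "D \<in> {D. dissection V D \<and> card D + 1 = k \<and> (i, j) \<in> D}"
    hence D: "dissection V D" "card D + 1 = k" "(i, j) \<in> D" by auto
    note cut = dissection_cut[OF D(1,3)]
    show "(\<lambda>(l, D1, D2). insert (i, j) (D1 \<union> D2))
        (card (D \<inter> diagonals inner) + 1, D \<inter> diagonals inner, D \<inter> diagonals outer) = D"
      using cut(3) by simp
    have "card D = card (D \<inter> diagonals inner) + card (D \<inter> diagonals outer) + 1"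
      using card_glue[OF cut(1,2)] unfolding cut(3) .
    thus "(card (D \<inter> diagonals inner) + 1, D \<inter> diagonals inner, D \<inter> diagonals outer) \<in> ?S"
      using cut D by auto
  qed
  finally show ?thesis ..
qed

text \<open>Each dissection counted has \<open>k - 1\<close> diagonals; exchanging the two sums
  fixes the diagonal and lets the dissection vary.\<close>

lemma dissection_weight_times_diagonals:
  assumes "finite V"
  shows "(k - 1) * dissection_weight w V k =
    (\<Sum>(i, j)\<in>diagonals V. \<Sum>l = 1..k - 1.
      dissection_weight w (V \<inter> {i..j}) l * dissection_weight w (V - {i<..<j}) (k - l))"
proof -
  let ?A = "{D. dissection V D \<and> card D + 1 = k}"
  let ?g = "\<lambda>D. \<Prod>P\<in>parts V D. w (card P)"
  have finA: "finite ?A" using finite_dissections[OF assms] by (auto intro: rev_finite_subset)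
  have "(k - 1) * dissection_weight w V k = (\<Sum>D\<in>?A. card D * ?g D)"
    unfolding dissection_weight_def sum_distrib_left by (intro sum.cong) auto
  also have "\<dots> = (\<Sum>D\<in>?A. \<Sum>d | d \<in> diagonals V \<and> d \<in> D. ?g D)"
  proof (intro sum.cong refl)
    fix D assume "D \<in> ?A"
    hence "{d. d \<in> diagonals V \<and> d \<in> D} = D" by (auto simp: dissection_def)
    thus "card D * ?g D = (\<Sum>d | d \<in> diagonals V \<and> d \<in> D. ?g D)" by simp
  qed
  also have "\<dots> = (\<Sum>d\<in>diagonals V. \<Sum>D | D \<in> ?A \<and> d \<in> D. ?g D)"
    by (rule sum.swap_restrict[OF finA finite_diagonals[OF assms]])
  also have "\<dots> = (\<Sum>(i, j)\<in>diagonals V. \<Sum>l = 1..k - 1.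
      dissection_weight w (V \<inter> {i..j}) l * dissection_weight w (V - {i<..<j}) (k - l))"
  proof (intro sum.cong refl, clarify)
    fix i j assume "(i, j) \<in> diagonals V"
    then interpret cut_polygon V i j using assms by unfold_locales
    have "{D. D \<in> ?A \<and> (i, j) \<in> D} = {D. dissection V D \<and> card D + 1 = k \<and> (i, j) \<in> D}"
      by auto
    thus "(\<Sum>D | D \<in> ?A \<and> (i, j) \<in> D. ?g D) = (\<Sum>l = 1..k - 1.
        dissection_weight w (V \<inter> {i..j}) l * dissection_weight w (V - {i<..<j}) (k - l))"
      using sum_dissections_through_diagonal[where k = k and w = w] by (simp add: inner_def outer_def)
  qed
  finally show ?thesis .
qed


section \<open>Diagonals sorted by length\<close>

lemma strict_mono_enumeration:
  assumes "finite (V :: nat set)"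
  obtains h where "bij_betw h {..<card V} V"
    "\<And>s t. s < card V \<Longrightarrow> t < card V \<Longrightarrow> h s < h t \<longleftrightarrow> s < t"
proof -
  let ?xs = "sorted_list_of_set V"
  have len: "length ?xs = card V" by simp
  have bij: "bij_betw ((!) ?xs) {..<card V} V"
    using assms by (intro bij_betw_nth) auto
  have mono: "?xs ! s < ?xs ! t" if "s < t" "t < card V" for s t
    using that len strict_sorted_list_of_set[of V] by (auto simp: sorted_wrt_iff_nth_less)
  have "?xs ! s < ?xs ! t \<longleftrightarrow> s < t" if "s < card V" "t < card V" for s t
    using mono[of s t] mono[of t s] that by (cases s t rule: linorder_cases) auto
  with bij show ?thesis using that by blast
qed

text \<open>Number the vertices increasingly from 0 and let \<open>t\<close> be the difference of
  the positions of the two ends. There are \<open>card V - t\<close> starting positions, and the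
  pieces have \<open>t + 1\<close> and \<open>card V - t + 1\<close> vertices. The differences 1 and
  \<open>card V - 1\<close> belong to sides.\<close>

lemma sum_diagonals_by_length:
  fixes g :: "nat \<Rightarrow> nat \<Rightarrow> nat"
  assumes "finite V"
  shows "(\<Sum>(i, j)\<in>diagonals V. g (card (V \<inter> {i..j})) (card (V - {i<..<j}))) =
    (\<Sum>t = 2..card V - 2. (card V - t) * g (t + 1) (card V - t + 1))"
proof -
  define N where "N = card V"
  obtain h where bij: "bij_betw h {..<N} V"
    and less: "\<And>s t. s < N \<Longrightarrow> t < N \<Longrightarrow> h s < h t \<longleftrightarrow> s < t"
    using strict_mono_enumeration[OF assms] unfolding N_def by blast
  have inj: "inj_on h {..<N}" and V: "V = h ` {..<N}"
    using bij by (auto simp: bij_betw_def)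
  define h' where "h' = inv_into {..<N} h"
  have h': "h' (h s) = s" if "s < N" for s
    using that inj by (simp add: h'_def)
  have le: "h s \<le> h t \<longleftrightarrow> s \<le> t" if "s < N" "t < N" for s t
    using less[of t s] that by (meson not_le)
  have diag: "(h s, h u) \<in> diagonals V \<longleftrightarrow> s + 2 \<le> u \<and> u - s \<le> N - 2" if "s < N" "u < N" for s u
  proof
    assume "(h s, h u) \<in> diagonals V"
    then obtain v v' where v: "v < N" "v' < N" "h s < h v" "h v < h u" "h v' < h s \<or> h u < h v'"
      unfolding diagonals_iff V by auto
    hence "s < v" "v < u" "v' < s \<or> u < v'" using less that by auto
    thus "s + 2 \<le> u \<and> u - s \<le> N - 2" using v that by auto
  next
    assume a: "s + 2 \<le> u \<and> u - s \<le> N - 2"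
    have "s + 1 < N" using a that by auto
    hence "\<exists>v\<in>V. h s < h u \<and> h s < v \<and> v < h u"
      using a that less by (auto simp: V intro!: bexI[of _ "s + 1"])
    \<comment> \<open>The outside vertex is the one after \<open>h u\<close> if the diagonal starts
      at the first vertex, and the first vertex otherwise.\<close>
    moreover have "\<exists>v\<in>V. v < h s \<or> h u < v"
    proof (cases "s = 0")
      case True
      hence "h u < h (u + 1)" "u + 1 < N" using a that less by auto
      thus ?thesis by (auto simp: V)
    next
      case False
      hence "h 0 < h s" "0 < N" using that less by auto
      thus ?thesis by (auto simp: V)
    qed
    ultimately show "(h s, h u) \<in> diagonals V" using that unfolding diagonals_iff V by auto
  qed
  have inner_card: "card (V \<inter> {h s..h (s + t)}) = t + 1" if "s + t < N" for s t
  proof -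
    have "V \<inter> {h s..h (s + t)} = h ` {s..s + t}" using that le by (auto simp: V)
    moreover have "inj_on h {s..s + t}" using that by (intro inj_on_subset[OF inj]) auto
    ultimately show ?thesis by (simp add: card_image)
  qed
  have "(\<Sum>t = 2..N - 2. (N - t) * g (t + 1) (N - t + 1)) =
      (\<Sum>t = 2..N - 2. \<Sum>s<N - t. g (t + 1) (N - t + 1))" by simp
  also have "\<dots> = (\<Sum>(t, s)\<in>(SIGMA t:{2..N - 2}. {..<N - t}). g (t + 1) (N - t + 1))"
    by (rule sum.Sigma) auto
  also have "\<dots> = (\<Sum>(i, j)\<in>diagonals V. g (card (V \<inter> {i..j})) (card (V - {i<..<j})))"
  proof (rule sum.reindex_bij_witness[where j = "\<lambda>(t, s). (h s, h (s + t))" and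
        i = "\<lambda>(x, y). (h' y - h' x, h' x)"])
    fix p assume "p \<in> (SIGMA t:{2..N - 2}. {..<N - t})"
    then obtain t s where p: "p = (t, s)" "2 \<le> t" "t \<le> N - 2" "s + t < N" by auto
    have d: "(h s, h (s + t)) \<in> diagonals V" using diag[of s "s + t"] p by simp
    thus "(case p of (t, s) \<Rightarrow> (h s, h (s + t))) \<in> diagonals V" using p by simp
    show "(case case p of (t, s) \<Rightarrow> (h s, h (s + t)) of (x, y) \<Rightarrow> (h' y - h' x, h' x)) = p"
      using p by (simp add: h')
    interpret cut_polygon V "h s" "h (s + t)" using assms d by unfold_locales
    have "card (V - {h s<..<h (s + t)}) = N - t + 1"
      using card_inner_outer inner_card[OF p(4)] p by (simp add: inner_def outer_def N_def)
    thus "(case case p of (t, s) \<Rightarrow> (h s, h (s + t)) of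
          (i, j) \<Rightarrow> g (card (V \<inter> {i..j})) (card (V - {i<..<j}))) =
        (case p of (t, s) \<Rightarrow> g (t + 1) (N - t + 1))"
      using inner_card[OF p(4)] p by simp
  next
    fix e assume e: "e \<in> diagonals V"
    then obtain s u where su: "e = (h s, h u)" "s < N" "u < N"
      by (cases e) (auto simp: diagonals_iff V)
    have "s + 2 \<le> u \<and> u - s \<le> N - 2" using diag su e by simp
    thus "(case case e of (x, y) \<Rightarrow> (h' y - h' x, h' x) of (t, s) \<Rightarrow> (h s, h (s + t))) = e"
      "(case e of (x, y) \<Rightarrow> (h' y - h' x, h' x)) \<in> (SIGMA t:{2..N - 2}. {..<N - t})"
      using su by (auto simp: h')
  qed
  finally show ?thesis unfolding N_def ..
qed

section \<open>Dependence on the number of vertices only, and the resulting recursion\<close>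

lemma dissection_weight_0: "dissection_weight w V 0 = 0"
  by (simp add: dissection_weight_def)

lemma dissection_weight_1:
  assumes "finite V" "card V \<ge> 3"
  shows "dissection_weight w V 1 = w (card V)"
proof -
  have "{D. dissection V D \<and> card D + 1 = 1} = {{}}"
    using finite_dissection[OF assms(1)] by (auto simp: dissection_def)
  thus ?thesis using parts_empty[OF assms] by (simp add: dissection_weight_def)
qed

text \<open>The double count expresses \<open>k - 1\<close> times the weight through weights with
  fewer parts. By induction these may be taken on the polygons \<open>{0..<x}\<close>, and then
  sorting the diagonals by length leaves only \<open>card U\<close>.\<close>

lemma dissection_weight_cong_card:
  assumes "finite V" "finite V'" "card V = card V'" "card V \<ge> 3"
  shows "dissection_weight w V k = dissection_weight w V' k"
  using assms
proof (induction k arbitrary: V V' rule: less_induct)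
  case (less k)
  have rec: "(k - 1) * dissection_weight w U k =
      (\<Sum>t = 2..card U - 2. (card U - t) * (\<Sum>l = 1..k - 1.
        dissection_weight w {0..<t + 1} l * dissection_weight w {0..<card U - t + 1} (k - l)))"
    if U: "finite U" for U
  proof -
    have "(k - 1) * dissection_weight w U k =
      (\<Sum>(i, j)\<in>diagonals U. \<Sum>l = 1..k - 1. dissection_weight w {0..<card (U \<inter> {i..j})} l *
        dissection_weight w {0..<card (U - {i<..<j})} (k - l))"
      unfolding dissection_weight_times_diagonals[OF U]
    proof (intro sum.cong refl, clarify)
      fix i j assume "(i, j) \<in> diagonals U"
      then interpret cut_polygon U i j using U by unfold_locales
      show "(\<Sum>l = 1..k - 1. dissection_weight w (U \<inter> {i..j}) l *
            dissection_weight w (U - {i<..<j}) (k - l)) =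
          (\<Sum>l = 1..k - 1. dissection_weight w {0..<card (U \<inter> {i..j})} l *
            dissection_weight w {0..<card (U - {i<..<j})} (k - l))"
      proof (intro sum.cong refl arg_cong2[where f = "(*)"])
        fix l assume "l \<in> {1..k - 1}"
        hence l: "l < k" "k - l < k" by auto
        show "dissection_weight w (U \<inter> {i..j}) l = dissection_weight w {0..<card (U \<inter> {i..j})} l"
          using less.IH[OF l(1) finite_inner, of "{0..<card inner}"] card_inner
          by (simp add: inner_def)
        show "dissection_weight w (U - {i<..<j}) (k - l) =
            dissection_weight w {0..<card (U - {i<..<j})} (k - l)"
          using less.IH[OF l(2) finite_outer, of "{0..<card outer}"] card_outer
          by (simp add: outer_def)
      qed
    qed
    thus ?thesis
      using sum_diagonals_by_length[OF U, of "\<lambda>x y. \<Sum>l = 1..k - 1.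
        dissection_weight w {0..<x} l * dissection_weight w {0..<y} (k - l)"] by simp
  qed
  \<comment> \<open>The factor \<open>k - 1\<close> vanishes for \<open>k \<le> 1\<close>, by
    truncation when \<open>k = 0\<close>, so these weights are computed directly.\<close>
  consider "k = 0" | "k = 1" | "k > 1" by linarith
  thus ?case
  proof cases
    case 3
    have "(k - 1) * dissection_weight w V k = (k - 1) * dissection_weight w V' k"
      unfolding rec[OF less.prems(1)] rec[OF less.prems(2)] less.prems(3) ..
    thus ?thesis using 3 by simp
  qed (use less.prems in \<open>simp_all add: dissection_weight_0 dissection_weight_1[simplified]\<close>)
qed

text \<open>
  A diagonal of length \<open>t\<close> and one of length \<open>N - t\<close> cut an \<open>N\<close>-gon into the same pair of polygons,
  and there are \<open>N - t\<close> and \<open>t\<close> of them: averaging the two replaces the count by \<open>N / 2\<close>.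
\<close>

lemma dissection_weight_recursion:
  "2 * (k - 1) * dissection_weight w {0..<N} k =
    N * (\<Sum>l = 1..k - 1. \<Sum>t = 2..N - 2.
      dissection_weight w {0..<t + 1} l * dissection_weight w {0..<N - t + 1} (k - l))"
proof -
  let ?W = "\<lambda>x. dissection_weight w {0..<x}"
  let ?F = "\<lambda>x y. \<Sum>l = 1..k - 1. ?W x l * ?W y (k - l)"
  \<comment> \<open>Replacing \<open>l\<close> by \<open>k - l\<close> exchanges the two
    pieces.\<close>
  have F_sym: "?F x y = ?F y x" for x y
    by (rule sum.reindex_bij_witness[where i = "\<lambda>l. k - l" and j = "\<lambda>l. k - l"])
      (auto simp: mult.commute)
  have "(k - 1) * ?W N k = (\<Sum>(i, j)\<in>diagonals {0..<N}.
      ?F (card ({0..<N} \<inter> {i..j})) (card ({0..<N} - {i<..<j})))"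
    unfolding dissection_weight_times_diagonals[OF finite_atLeastLessThan]
  proof (intro sum.cong refl, clarify)
    fix i j assume "(i, j) \<in> diagonals {0..<N}"
    then interpret cut_polygon "{0..<N}" i j by unfold_locales auto
    have "dissection_weight w inner l = ?W (card inner) l"
      "dissection_weight w outer l = ?W (card outer) l" for l
      using card_inner card_outer finite_inner finite_outer
      by (auto intro!: dissection_weight_cong_card)
    thus "(\<Sum>l = 1..k - 1. dissection_weight w ({0..<N} \<inter> {i..j}) l *
          dissection_weight w ({0..<N} - {i<..<j}) (k - l)) =
        ?F (card ({0..<N} \<inter> {i..j})) (card ({0..<N} - {i<..<j}))"
      by (simp add: inner_def outer_def)
  qed
  also have "\<dots> = (\<Sum>t = 2..N - 2. (N - t) * ?F (t + 1) (N - t + 1))"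
    using sum_diagonals_by_length[of "{0..<N}" ?F] by simp
  finally have 1: "(k - 1) * ?W N k = (\<Sum>t = 2..N - 2. (N - t) * ?F (t + 1) (N - t + 1))" .
  also have "\<dots> = (\<Sum>t = 2..N - 2. t * ?F (t + 1) (N - t + 1))"
    by (rule sum.reindex_bij_witness[where i = "\<lambda>t. N - t" and j = "\<lambda>t. N - t"])
      (auto simp: F_sym[unfolded One_nat_def])
  finally have "2 * (k - 1) * ?W N k =
      (\<Sum>t = 2..N - 2. (N - t) * ?F (t + 1) (N - t + 1) + t * ?F (t + 1) (N - t + 1))"
    using 1 by (simp add: sum.distrib)
  also have "\<dots> = (\<Sum>t = 2..N - 2. N * ?F (t + 1) (N - t + 1))"
    by (intro sum.cong refl) (auto simp flip: add_mult_distrib)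
  also have "\<dots> = N * (\<Sum>l = 1..k - 1. \<Sum>t = 2..N - 2. ?W (t + 1) l * ?W (N - t + 1) (k - l))"
    by (simp add: sum_distrib_left sum.swap[of _ "{2..N - 2}"])
  finally show ?thesis .
qed

section \<open>Colored partitions in terms of the excess\<close>

lemma finite_colors:
  assumes "a \<ge> 1"
  shows "finite (colors a b c s)"
proof (rule finite_subset)
  \<comment> \<open>Since \<open>a \<ge> 1\<close>, the equation \<open>s = a * j + b\<close> forces
    \<open>j \<le> s\<close>.\<close>
  show "colors a b c s \<subseteq> (\<Union>j\<in>{..s}. {..<c j})"
    using assms by (fastforce simp: colors_def intro: trans_le_add1)
qed auto

text \<open>The index \<open>r\<close> is the number of vertices minus two, which is additive under
  cutting. It is an integer because it may become negative, and the value 0 for \<open>r < 1\<close>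
  reflects that no such polygon exists.\<close>

definition weight_of_excess :: "nat \<Rightarrow> nat \<Rightarrow> (nat \<Rightarrow> nat) \<Rightarrow> int \<Rightarrow> nat \<Rightarrow> nat" where
  "weight_of_excess a b c r k =
    (if r \<ge> 1 then dissection_weight (\<lambda>s. card (colors a b c s)) {0..<nat (r + 2)} k else 0)"

text \<open>As a dissection has \<open>card D + 1\<close> parts, the colored partitions form a
  dependent sum over dissections of spaces of colorings, whose sizes are products of numbers of
  colors.\<close>

lemma card_colored_partitions:
  assumes "a \<ge> 1"
  shows "card (colored_partitions a b c r k) = weight_of_excess a b c r k"
proof (cases "r \<ge> 1")
  case True
  let ?V = "{0..<nat (r + 2)}"
  let ?A = "{D. dissection ?V D \<and> card D + 1 = k}"
  have "card (parts ?V D) = card D + 1" if "dissection ?V D" for D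
    using card_parts_and_excess[OF _ _ that] True by simp
  hence "colored_partitions a b c r k =
      (SIGMA D:?A. \<Pi>\<^sub>E P \<in> parts ?V D. colors a b c (card P))"
    using True by (auto simp: colored_partitions_def)
  moreover have "finite ?A"
    by (rule finite_subset[OF _ finite_dissections[of ?V]]) auto
  ultimately show ?thesis
    using True assms
    by (simp add: card_SigmaI finite_PiE finite_parts finite_colors card_PiE
        weight_of_excess_def dissection_weight_def)
next
  case False
  hence "colored_partitions a b c r k = {}" by (auto simp: colored_partitions_def)
  thus ?thesis using False by (simp add: weight_of_excess_def)
qed

text \<open>Some dissection has only colorable parts, so each part \<open>P\<close> is an
  \<open>(a * J P + b)\<close>-gon with \<open>J P \<ge> 1\<close>. Adding the excesses of the
  \<open>k\<close> parts gives the formula with \<open>m\<close> the sum of all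
  \<open>J P\<close>.\<close>

lemma weight_of_excess_support:
  assumes "weight_of_excess a b c r k \<noteq> 0"
  obtains m where "m \<ge> k" "r = int a * int m + (int b - 2) * int k"
proof -
  let ?V = "{0..<nat (r + 2)}"
  have r: "r \<ge> 1" using assms by (auto simp: weight_of_excess_def split: if_splits)
  hence "(\<Sum>D | dissection ?V D \<and> card D + 1 = k.
      \<Prod>P\<in>parts ?V D. card (colors a b c (card P))) \<noteq> 0"
    using assms by (simp add: weight_of_excess_def dissection_weight_def)
  from sum.not_neutral_contains_not_neutral[OF this]
  obtain D where D: "dissection ?V D" "card D + 1 = k"
    and nz: "(\<Prod>P\<in>parts ?V D. card (colors a b c (card P))) \<noteq> 0"
    by blast
  have fin: "finite (parts ?V D)" by (simp add: finite_parts)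
  have "colors a b c (card P) \<noteq> {}" if "P \<in> parts ?V D" for P
    using nz that fin by (metis card.empty prod_zero)
  hence "\<forall>P\<in>parts ?V D. \<exists>j\<ge>1. card P = a * j + b" by (fastforce simp: colors_def)
  then obtain J where J: "\<And>P. P \<in> parts ?V D \<Longrightarrow> J P \<ge> 1 \<and> card P = a * J P + b" by metis
  have ex: "card (parts ?V D) = k" "(\<Sum>P\<in>parts ?V D. int (card P) - 2) = r"
    using card_parts_and_excess[OF _ _ D(1)] D(2) r by auto
  have "r = (\<Sum>P\<in>parts ?V D. int (card P) - 2)" using ex(2) ..
  also have "\<dots> = (\<Sum>P\<in>parts ?V D. int a * int (J P) + (int b - 2))"
    using J by (intro sum.cong) auto
  also have "\<dots> = int a * int (\<Sum>P\<in>parts ?V D. J P) + (int b - 2) * int k"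
    by (simp add: sum.distrib sum_distrib_left ex(1))
  finally have "r = int a * int (\<Sum>P\<in>parts ?V D. J P) + (int b - 2) * int k" .
  moreover have "k \<le> (\<Sum>P\<in>parts ?V D. J P)"
    using sum_mono[of "parts ?V D" "\<lambda>_. 1" J] J ex(1) by simp
  ultimately show ?thesis using that by blast
qed

lemma weight_of_excess_recursion:
  assumes "r \<ge> 1"
  shows "2 * (k - 1) * weight_of_excess a b c r k = nat (r + 2) *
    (\<Sum>l = 1..k - 1. \<Sum>q\<in>{1..r - 1}.
      weight_of_excess a b c q l * weight_of_excess a b c (r - q) (k - l))"
proof -
  let ?W = "\<lambda>x. dissection_weight (\<lambda>s. card (colors a b c s)) {0..<x}"
  have "(\<Sum>t = 2..nat (r + 2) - 2. ?W (t + 1) l * ?W (nat (r + 2) - t + 1) (k - l)) =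
      (\<Sum>q\<in>{1..r - 1}. weight_of_excess a b c q l * weight_of_excess a b c (r - q) (k - l))" for l
  \<comment> \<open>A piece with \<open>t + 1\<close> vertices has excess \<open>q = t - 1\<close>,
    and the other piece has the remaining excess \<open>r - q\<close>.\<close>
  proof (rule sum.reindex_bij_witness[where i = "\<lambda>q. nat (q + 1)" and j = "\<lambda>t. int t - 1"])
    fix t assume "t \<in> {2..nat (r + 2) - 2}"
    hence t: "int t \<ge> 2" "int t \<le> r" using assms by auto
    hence "nat (int t - 1 + 2) = t + 1" "nat (r - (int t - 1) + 2) = nat (r + 2) - t + 1"
      by auto
    thus "weight_of_excess a b c (int t - 1) l * weight_of_excess a b c (r - (int t - 1)) (k - l) =
        ?W (t + 1) l * ?W (nat (r + 2) - t + 1) (k - l)"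
      using t by (simp add: weight_of_excess_def)
  qed (use assms in auto)
  thus ?thesis
    using dissection_weight_recursion[of k "\<lambda>s. card (colors a b c s)" "nat (r + 2)"] assms
    by (simp add: weight_of_excess_def)
qed

section \<open>From excesses back to the parameter \<open>n\<close>\<close>

theorem theorem1:
  fixes a b n k :: nat and c :: "nat \<Rightarrow> nat" and r :: int
  assumes "a \<ge> 1" and "b \<ge> 1" and "n \<ge> 1" and "k > 1"
    and "r = int a * int n + (int b - 2) * int k"
  shows "2 * (real k - 1) / (real_of_int r + 2) * real (p_hat a b c n k) =
    (\<Sum>l = 1..k - 1. \<Sum>m = l..n - 1. real (p_hat a b c (n - m) (k - l)) * real (p_hat a b c m l))"
proof -
  let ?w = "weight_of_excess a b c"
  \<comment> \<open>The excess of the polygon whose partitions \<open>p_hat a b c m l\<close>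
    counts.\<close>
  define e where "e l m = int a * int m + (int b - 2) * int l" for l m :: nat
  have p: "p_hat a b c m l = ?w (e l m) l" for m l
    by (simp add: p_hat_def card_colored_partitions[OF assms(1)] e_def)
  have support: "1 \<le> q" if "?w q l \<noteq> 0" for q l
    using that by (auto simp: weight_of_excess_def split: if_splits)
  have inj: "inj_on (e l) A" for l A
    using assms(1) by (auto simp: inj_on_def e_def)
  have r: "r = e k n" by (simp add: e_def assms(5))
  have split: "e (k - l) (n - m) = r - e l m" if "l \<le> k" "m \<le> n" for l m
    using that by (simp add: r e_def of_nat_diff algebra_simps)
  \<comment> \<open>For fixed \<open>l\<close> the map \<open>e l\<close> is injective, so the sum
    over \<open>m\<close> is a sum over excesses; outside the common range of the two index sets
    every term vanishes.\<close>
  have inner_sum: "(\<Sum>m = l..n - 1. p_hat a b c (n - m) (k - l) * p_hat a b c m l) =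
      (\<Sum>q\<in>{1..r - 1}. ?w q l * ?w (r - q) (k - l))" if l: "l \<in> {1..k - 1}" for l
  proof -
    have "(\<Sum>m = l..n - 1. p_hat a b c (n - m) (k - l) * p_hat a b c m l) =
        (\<Sum>m = l..n - 1. ?w (e l m) l * ?w (r - e l m) (k - l))"
    proof (intro sum.cong refl)
      fix m assume "m \<in> {l..n - 1}"
      hence "e (k - l) (n - m) = r - e l m" using l by (intro split) auto
      thus "p_hat a b c (n - m) (k - l) * p_hat a b c m l = ?w (e l m) l * ?w (r - e l m) (k - l)"
        by (simp add: p)
    qed
    also have "\<dots> = (\<Sum>q\<in>e l ` {l..n - 1}. ?w q l * ?w (r - q) (k - l))"
      by (simp add: sum.reindex[OF inj])
    also have "\<dots> = (\<Sum>q\<in>{1..r - 1}. ?w q l * ?w (r - q) (k - l))"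
    proof (rule sum.mono_neutral_cong)
      show "?w q l * ?w (r - q) (k - l) = 0" if "q \<in> {1..r - 1} - e l ` {l..n - 1}" for q
      proof (rule ccontr)
        assume "\<not> ?thesis"
        hence nz: "?w q l \<noteq> 0" "?w (r - q) (k - l) \<noteq> 0" by auto
        obtain m where m: "m \<ge> l" "q = e l m"
          using weight_of_excess_support[OF nz(1)] unfolding e_def by blast
        obtain m' where m': "m' \<ge> k - l" "r - q = e (k - l) m'"
          using weight_of_excess_support[OF nz(2)] unfolding e_def by blast
        \<comment> \<open>Both sides equal \<open>r\<close>. Injectivity of \<open>e k\<close>
          yields \<open>n = m + m'\<close>, and \<open>m' \<ge> k - l \<ge> 1\<close> gives
          \<open>m \<le> n - 1\<close>.\<close>
        have "e k n = e k (m + m')"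
        proof -
          have "int (k - l) = int k - int l" using l by auto
          thus ?thesis using m(2) m'(2) by (simp add: r e_def algebra_simps)
        qed
        hence "n = m + m'" using inj[of k UNIV] by (auto dest: injD)
        hence "m \<in> {l..n - 1}" using m m' l by auto
        thus False using that m by auto
      qed
      \<comment> \<open>Here \<open>q < 1\<close> or \<open>r - q < 1\<close>, so one of the pieces
        does not exist.\<close>
      show "?w q l * ?w (r - q) (k - l) = 0" if "q \<in> e l ` {l..n - 1} - {1..r - 1}" for q
        using that support[of q l] support[of "r - q" "k - l"] by (cases "1 \<le> q") force+
    qed auto
    finally show ?thesis .
  qed
  have cast: "(\<Sum>l = 1..k - 1. \<Sum>m = l..n - 1.
        real (p_hat a b c (n - m) (k - l)) * real (p_hat a b c m l)) =
      real (\<Sum>l = 1..k - 1. \<Sum>m = l..n - 1. p_hat a b c (n - m) (k - l) * p_hat a b c m l)"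
    by simp
  show ?thesis
  proof (cases "r \<ge> 1")
    case True
    have "real (2 * (k - 1) * ?w r k) = real (nat (r + 2) *
        (\<Sum>l = 1..k - 1. \<Sum>m = l..n - 1. p_hat a b c (n - m) (k - l) * p_hat a b c m l))"
      using weight_of_excess_recursion[OF True, of k a b c] inner_sum by simp
    thus ?thesis
      using True assms(4) by (simp add: p r[symmetric] of_nat_diff field_simps)
  next
    \<comment> \<open>This occurs only for \<open>b = 1\<close>. The polygon does not exist and the
      range \<open>{1..r - 1}\<close> is empty, so both sides are 0 whatever the quotient by
      \<open>r + 2\<close> is, even at \<open>r = -2\<close>.\<close>
    case False
    have "(\<Sum>l = 1..k - 1. \<Sum>m = l..n - 1. p_hat a b c (n - m) (k - l) * p_hat a b c m l) = 0"
      using False by (subst sum.cong[OF refl inner_sum]) auto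
    moreover have "p_hat a b c n k = 0" using False by (simp add: p r[symmetric] weight_of_excess_def)
    ultimately show ?thesis unfolding cast by (simp only: of_nat_0 mult_zero_right)
  qed
qed

end
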